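(* Let $d\ge 1$ and suppose $A, B \in \mathrm{GL}(2d,\mathbb R)$ are such that $A^T J A = B^T J B$ (so that $BA^{-1}$ is symplectic). Let $U$ be any unitary operator on $L^2(\mathbb R^d)$ that is $\rho$-related to the symplectic matrix $BA^{-1}$. Then the following statements are true for all $g, h \in L^2(\mathbb R^d)$. (i) $\mathcal G(g, A)$ is a Bessel sequence if and only if $\mathcal G(Ug, B)$ is a Bessel sequence. (ii) $\mathcal G(g, A)$ is a Gabor frame if and only if $\mathcal G(Ug, B)$ is a Gabor frame. (iii) If $\mathcal G(g, A)$ and $\mathcal G(h, A)$ are Bessel sequences, then $S^B_{Ug, Uh} = U\, S^A_{g, h}\, U^*$. In the case of (i) (respectively (ii)), the optimal Bessel bounds (respectively the optimal frame bounds) of $\mathcal G(g, A)$ and $\mathcal G(Ug, B)$ are equal. Moreover, (i), (ii) and (iii) are all true with $A^\circ$ and $B^\circ$ in place of $A$ and $B$, with the same operator $U$.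
   Context: $J = \begin{pmatrix} 0 & I \\ -I & 0\end{pmatrix}$ is the standard $2d\times 2d$ symplectic matrix ($I$ the $d\times d$ identity). $\mathrm{Sp}(2d,\mathbb R)=\{S : S^TJS=J\}$; its elements are called symplectic matrices. For $x,\omega\in\mathbb R^d$, $T_xf(t)=f(t-x)$ and $M_\omega f(t)=e^{2\pi i t\cdot\omega}f(t)$ on $L^2(\mathbb R^d)$; for $z=(x,\omega)\in\mathbb R^{2d}$, $\pi(z)=M_\omega T_x$ and $\rho(z)=e^{-\pi i x\cdot\omega}\pi(z)$. A unitary operator $U$ on $L^2(\mathbb R^d)$ is $\rho$-related to $S\in\mathrm{Sp}(2d,\mathbb R)$ if $U\rho(z)U^*=\rho(Sz)$ for all $z\in\mathbb R^{2d}$ (for every symplectic $S$ such a $U$ exists; this is a known fact). For $A\in\mathrm{GL}(2d,\mathbb R)$ and $g\in L^2(\mathbb R^d)$, the Gabor system is $\mathcal G(g,A)=\{\pi(Ak)g : k\in\mathbb Z^{2d}\}$. It is a Bessel sequence if there is $C_2>0$ with $\sum_{k\in\mathbb Z^{2d}}|\langle f,\pi(Ak)g\rangle|^2\le C_2\|f\|^2$ for all $f\in L^2(\mathbb R^d)$, and a (Gabor) frame if in addition there is $C_1>0$ with $C_1\|f\|^2\le\sum_{k}|\langle f,\pi(Ak)g\rangle|^2$ for all $f$. The optimal Bessel bound is the smallest possible $C_2$; the optimal frame bounds are the largest possible $C_1$ and the smallest possible $C_2$. If $\mathcal G(g,A)$ and $\mathcal G(h,A)$ are Bessel sequences, the (mixed-type)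 frame operator is the bounded operator $S^A_{g,h}f=\sum_{k\in\mathbb Z^{2d}}\langle f,\pi(Ak)g\rangle\pi(Ak)h$ on $L^2(\mathbb R^d)$. Inner products are linear in the first argument. Finally $A^\circ := -JA^{-T}$, where $A^{-T}=(A^{-1})^T$. *)

theory Defs
  imports "HOL-Analysis.Analysis"
begin

section \<open>The Hilbert space of square-integrable functions\<close>

definition square_integrable :: "('a::euclidean_space \<Rightarrow> complex) \<Rightarrow> bool" where
  "square_integrable f \<longleftrightarrow>
     f \<in> borel_measurable lborel \<and> integrable lborel (\<lambda>t. (cmod (f t))\<^sup>2)"

lemma square_integrable_zero: "square_integrable (\<lambda>t. 0)"
  by (simp add: square_integrable_def)

lemma square_integrable_add:
  assumes "square_integrable f" "square_integrable g"
  shows "square_integrable (\<lambda>t. f t + g t)"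
  unfolding square_integrable_def
proof
  note [measurable] = assms[unfolded square_integrable_def, THEN conjunct1]
  show "(\<lambda>t. f t + g t) \<in> borel_measurable lborel" by measurable
  show "integrable lborel (\<lambda>t. (cmod (f t + g t))\<^sup>2)"
  proof (rule Bochner_Integration.integrable_bound)
    show "integrable lborel (\<lambda>t. 2 * (cmod (f t))\<^sup>2 + 2 * (cmod (g t))\<^sup>2)"
      using assms by (simp add: square_integrable_def)
    show "(\<lambda>t. (cmod (f t + g t))\<^sup>2) \<in> borel_measurable lborel" by measurable
    have "(cmod (x + y))\<^sup>2 \<le> 2 * (cmod x)\<^sup>2 + 2 * (cmod y)\<^sup>2" for x y
    proof -
      have "(cmod (x + y))\<^sup>2 \<le> (cmod x + cmod y)\<^sup>2"
        by (simp add: norm_triangle_ineq power_mono)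
      also have "\<dots> \<le> 2 * (cmod x)\<^sup>2 + 2 * (cmod y)\<^sup>2"
        using sum_squares_bound[of "cmod x" "cmod y"] by (simp add: power2_sum)
      finally show ?thesis .
    qed
    then show "AE t in lborel. norm ((cmod (f t + g t))\<^sup>2)
        \<le> norm (2 * (cmod (f t))\<^sup>2 + 2 * (cmod (g t))\<^sup>2)"
      by simp
  qed
qed

lemma square_integrable_mult_bounded:
  assumes f: "square_integrable f" and [measurable]: "c \<in> borel_measurable lborel"
    and c: "\<And>t. cmod (c t) \<le> K"
  shows "square_integrable (\<lambda>t. c t * f t)"
  unfolding square_integrable_def
proof
  note [measurable] = f[unfolded square_integrable_def, THEN conjunct1]
  show "(\<lambda>t. c t * f t) \<in> borel_measurable lborel" by measurable
  show "integrable lborel (\<lambda>t. (cmod (c t * f t))\<^sup>2)"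
  proof (rule Bochner_Integration.integrable_bound)
    show "integrable lborel (\<lambda>t. K\<^sup>2 * (cmod (f t))\<^sup>2)"
      using f by (simp add: square_integrable_def)
    show "(\<lambda>t. (cmod (c t * f t))\<^sup>2) \<in> borel_measurable lborel" by measurable
    show "AE t in lborel. norm ((cmod (c t * f t))\<^sup>2) \<le> norm (K\<^sup>2 * (cmod (f t))\<^sup>2)"
      by (auto simp: norm_mult power_mult_distrib intro!: AE_I2 mult_right_mono power_mono c)
  qed
qed

lemma square_integrable_cmult: "square_integrable f \<Longrightarrow> square_integrable (\<lambda>t. c * f t)"
  by (rule square_integrable_mult_bounded[where K = "cmod c"]) auto

lemma measurable_cnj [measurable]: "cnj \<in> borel_measurable borel"
  by (intro borel_measurable_continuous_onI continuous_intros)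

lemma square_integrable_mult_cnj:
  assumes "square_integrable f" "square_integrable g"
  shows "integrable lborel (\<lambda>t. f t * cnj (g t))"
proof (rule Bochner_Integration.integrable_bound)
  note [measurable] = assms[unfolded square_integrable_def, THEN conjunct1]
  show "integrable lborel (\<lambda>t. (cmod (f t))\<^sup>2 + (cmod (g t))\<^sup>2)"
    using assms by (simp add: square_integrable_def)
  show "(\<lambda>t. f t * cnj (g t)) \<in> borel_measurable lborel" by measurable
  have "cmod x * cmod y \<le> (cmod x)\<^sup>2 + (cmod y)\<^sup>2" for x y
  proof -
    have "2 * (cmod x * cmod y) \<le> (cmod x)\<^sup>2 + (cmod y)\<^sup>2"
      using sum_squares_bound[of "cmod x" "cmod y"] by simp
    moreover have "0 \<le> cmod x * cmod y" by simp
    ultimately show ?thesis by linarith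
  qed
  then show "AE t in lborel. norm (f t * cnj (g t)) \<le> norm ((cmod (f t))\<^sup>2 + (cmod (g t))\<^sup>2)"
    by (simp add: norm_mult)
qed

lemma measurable_translation [measurable]:
  "(\<lambda>t. t - x) \<in> lborel \<rightarrow>\<^sub>M (lborel :: 'a::euclidean_space measure)"
  by simp

lemma lborel_translation: "distr lborel lborel (\<lambda>t. t - x) = (lborel :: 'a::euclidean_space measure)"
proof -
  have "distr lborel lborel (\<lambda>t. t - x) = distr lborel borel ((+) (- x))"
    by (rule distr_cong) auto
  then show ?thesis by (simp only: lborel_distr_plus)
qed

lemma square_integrable_translation:
  assumes "square_integrable f" shows "square_integrable (\<lambda>t. f (t - x))"
  unfolding square_integrable_def
proof
  note [measurable] = assms[unfolded square_integrable_def, THEN conjunct1]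
  show "(\<lambda>t. f (t - x)) \<in> borel_measurable lborel" by measurable
  show "integrable lborel (\<lambda>t. (cmod (f (t - x)))\<^sup>2)"
    using assms integrable_distr[OF measurable_translation[of x], of "\<lambda>t. (cmod (f t))\<^sup>2"]
    by (simp add: lborel_translation square_integrable_def)
qed

lemma AE_translation:
  assumes "AE t in lborel. P t" shows "AE t in lborel. P (t - x)"
proof -
  have "AE t in distr lborel lborel (\<lambda>t. t - x). P t" using assms by (simp only: lborel_translation)
  then show ?thesis by (rule AE_distrD[OF measurable_translation])
qed

definition L2_rel :: "('a::euclidean_space \<Rightarrow> complex) \<Rightarrow> ('a \<Rightarrow> complex) \<Rightarrow> bool" where
  "L2_rel f g \<longleftrightarrow> square_integrable f \<and> square_integrable g \<and> (AE t in lborel. f t = g t)"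

lemma part_equivp_L2_rel: "part_equivp L2_rel"
proof (rule part_equivpI)
  show "\<exists>f. L2_rel f f"
    by (rule exI[of _ "\<lambda>t. 0"]) (simp add: L2_rel_def square_integrable_zero)
  show "symp L2_rel" by (rule sympI) (auto simp: L2_rel_def elim: eventually_mono)
  show "transp L2_rel" by (rule transpI) (auto simp: L2_rel_def elim: eventually_elim2)
qed

quotient_type (overloaded) 'a L2 = "'a::euclidean_space \<Rightarrow> complex" / partial: L2_rel
  by (rule part_equivp_L2_rel)

lift_definition cscale :: "complex \<Rightarrow> 'a::euclidean_space L2 \<Rightarrow> 'a L2" is "\<lambda>c f t. c * f t"
  by (auto simp: L2_rel_def square_integrable_cmult elim: eventually_mono)

lift_definition cinner :: "'a::euclidean_space L2 \<Rightarrow> 'a L2 \<Rightarrow> complex"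
  is "\<lambda>f g. LINT t|lborel. f t * cnj (g t)"
  by (rule integral_cong_AE)
     (auto simp: L2_rel_def elim: eventually_elim2
           intro: square_integrable_mult_cnj[THEN borel_measurable_integrable, simplified])

text \<open>The real inner product is the real part of the complex one; it induces the same norm, and its
  only purpose is to give access to the library's norm and topology.\<close>

instantiation L2 :: (euclidean_space) real_inner
begin

lift_definition zero_L2 :: "'a L2" is "\<lambda>t. 0"
  by (simp add: L2_rel_def square_integrable_zero)

lift_definition plus_L2 :: "'a L2 \<Rightarrow> 'a L2 \<Rightarrow> 'a L2" is "\<lambda>f g t. f t + g t"
  by (auto simp: L2_rel_def square_integrable_add elim: eventually_elim2)

definition uminus_L2 :: "'a L2 \<Rightarrow> 'a L2" where "- f = cscale (-1) f"

definition minus_L2 :: "'a L2 \<Rightarrow> 'a L2 \<Rightarrow> 'a L2" where "f - g = f + (- g :: 'a L2)"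

definition scaleR_L2 :: "real \<Rightarrow> 'a L2 \<Rightarrow> 'a L2" where "r *\<^sub>R f = cscale (of_real r) f"

definition inner_L2 :: "'a L2 \<Rightarrow> 'a L2 \<Rightarrow> real" where "inner f g = Re (cinner f g)"

lift_definition norm_L2 :: "'a L2 \<Rightarrow> real" is "\<lambda>f. sqrt (LINT t|lborel. (cmod (f t))\<^sup>2)"
  by (rule arg_cong[where f = sqrt], rule integral_cong_AE)
     (auto simp: L2_rel_def square_integrable_def elim: eventually_mono)

definition dist_L2 :: "'a L2 \<Rightarrow> 'a L2 \<Rightarrow> real" where "dist f g = norm (f - g :: 'a L2)"

definition sgn_L2 :: "'a L2 \<Rightarrow> 'a L2" where
  "sgn f = inverse (norm f) *\<^sub>R (f :: 'a L2)"

definition uniformity_L2 :: "('a L2 \<times> 'a L2) filter" where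
  "uniformity = (INF e\<in>{0<..}. principal {(f :: 'a L2, g). dist f g < e})"

definition open_L2 :: "'a L2 set \<Rightarrow> bool" where
  "open S \<longleftrightarrow> (\<forall>f\<in>(S :: 'a L2 set). \<forall>\<^sub>F (f', g) in uniformity. f' = f \<longrightarrow> g \<in> S)"

instance
proof
  fix f g h :: "'a L2" and r s :: real
  show "f + g + h = f + (g + h)"
    by transfer (auto simp: L2_rel_def add.assoc intro!: square_integrable_add)
  show "f + g = g + f"
    by transfer (auto simp: L2_rel_def add.commute intro!: square_integrable_add)
  show "0 + f = f"
    by transfer (auto simp: L2_rel_def)
  show "- f + f = 0"
    unfolding uminus_L2_def
    by transfer (auto simp: L2_rel_def square_integrable_zero)
  show "f - g = f + - g" by (fact minus_L2_def)
  show "r *\<^sub>R (f + g) = r *\<^sub>R f + r *\<^sub>R g"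
    unfolding scaleR_L2_def
    by transfer
      (auto simp: L2_rel_def distrib_left intro!: square_integrable_add square_integrable_cmult)
  show "(r + s) *\<^sub>R f = r *\<^sub>R f + s *\<^sub>R f"
    unfolding scaleR_L2_def
    by transfer
      (auto simp: L2_rel_def distrib_right intro!: square_integrable_add square_integrable_cmult)
  show "r *\<^sub>R s *\<^sub>R f = (r * s) *\<^sub>R f"
    unfolding scaleR_L2_def
    by transfer (auto simp: L2_rel_def mult.assoc intro!: square_integrable_cmult)
  show "1 *\<^sub>R f = f"
    unfolding scaleR_L2_def by transfer (auto simp: L2_rel_def)
  show "sgn f = inverse (norm f) *\<^sub>R f" by (fact sgn_L2_def)
  show "dist f g = norm (f - g)" by (fact dist_L2_def)
  show "(uniformity :: ('a L2 \<times> 'a L2) filter) = (INF e\<in>{0<..}. principal {(f, g). dist f g < e})"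
    by (fact uniformity_L2_def)
  show "open S \<longleftrightarrow> (\<forall>f\<in>S. \<forall>\<^sub>F (f', g) in uniformity. f' = f \<longrightarrow> g \<in> S)" for S :: "'a L2 set"
    by (fact open_L2_def)
  show "inner f g = inner g f"
    unfolding inner_L2_def
  proof transfer
    fix f g :: "'a \<Rightarrow> complex"
    have "(LINT t|lborel. g t * cnj (f t)) = (LINT t|lborel. cnj (f t * cnj (g t)))"
      by (simp add: mult.commute)
    also have "\<dots> = cnj (LINT t|lborel. f t * cnj (g t))"
      by (rule Bochner_Integration.integral_cnj)
    finally show "Re (LINT t|lborel. f t * cnj (g t)) = Re (LINT t|lborel. g t * cnj (f t))"
      by simp
  qed
  show "inner (f + g) h = inner f h + inner g h"
    unfolding inner_L2_def
    by transfer (auto simp: L2_rel_def distrib_right square_integrable_mult_cnj)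
  show "inner (r *\<^sub>R f) g = r * inner f g"
    unfolding inner_L2_def scaleR_L2_def by transfer (simp add: mult.assoc)
  have norm_sq: "inner f f = (norm f)\<^sup>2"
    unfolding inner_L2_def
  proof transfer
    fix f :: "'a \<Rightarrow> complex"
    have "(LINT t|lborel. f t * cnj (f t)) = (LINT t|lborel. complex_of_real ((cmod (f t))\<^sup>2))"
      by (simp only: complex_norm_square)
    also have "\<dots> = complex_of_real (LINT t|lborel. (cmod (f t))\<^sup>2)"
      by (rule integral_complex_of_real)
    finally show "Re (LINT t|lborel. f t * cnj (f t)) = (sqrt (LINT t|lborel. (cmod (f t))\<^sup>2))\<^sup>2"
      by simp
  qed
  show "0 \<le> inner f f" by (simp add: norm_sq)
  have "0 \<le> norm f" by transfer simp
  then show "norm f = sqrt (inner f f)" by (simp add: norm_sq)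
  have "norm f = 0 \<longleftrightarrow> f = 0"
  proof transfer
    fix f :: "'a \<Rightarrow> complex"
    assume "L2_rel f f"
    then have f: "square_integrable f" by (simp add: L2_rel_def)
    then have "(LINT t|lborel. (cmod (f t))\<^sup>2) = 0 \<longleftrightarrow> (AE t in lborel. (cmod (f t))\<^sup>2 = 0)"
      by (intro integral_nonneg_eq_0_iff_AE) (auto simp: square_integrable_def)
    then show "sqrt (LINT t|lborel. (cmod (f t))\<^sup>2) = 0 \<longleftrightarrow> L2_rel f (\<lambda>t. 0)"
      using f by (simp add: L2_rel_def square_integrable_zero)
  qed
  then show "inner f f = 0 \<longleftrightarrow> f = 0" by (simp add: norm_sq)
qed

end

section \<open>Unitary operators\<close>

definition cadjoint :: "('a::euclidean_space L2 \<Rightarrow> 'a L2) \<Rightarrow> ('a L2 \<Rightarrow> 'a L2)" where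
  "cadjoint T = (THE T'. \<forall>f g. cinner (T f) g = cinner f (T' g))"

definition unitary_operator :: "('a::euclidean_space L2 \<Rightarrow> 'a L2) \<Rightarrow> bool" where
  "unitary_operator U \<longleftrightarrow>
     (\<forall>f g. U (f + g) = U f + U g) \<and> (\<forall>c f. U (cscale c f) = cscale c (U f)) \<and>
     (\<forall>f g. cinner (U f) (U g) = cinner f g) \<and> surj U"

section \<open>Time-frequency shifts\<close>

text \<open>The index type \<open>'d + 'd\<close> has \<open>2 d\<close> elements: \<open>Inl\<close> selects the first and \<open>Inr\<close> the second
  block, so that \<open>z = (x, \<omega>)\<close> with \<open>x\<close> = \<open>time_part z\<close> and \<open>\<omega>\<close> = \<open>freq_part z\<close>.\<close>

definition time_part :: "real ^ ('d + 'd) \<Rightarrow> real ^ ('d::finite)" where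
  "time_part z = (\<chi> i. z $ Inl i)"

definition freq_part :: "real ^ ('d + 'd) \<Rightarrow> real ^ ('d::finite)" where
  "freq_part z = (\<chi> i. z $ Inr i)"

lift_definition translation :: "'a::euclidean_space \<Rightarrow> 'a L2 \<Rightarrow> 'a L2" is "\<lambda>x f t. f (t - x)"
  by (simp add: L2_rel_def square_integrable_translation AE_translation[where P = "\<lambda>t. _ t = _ t"])

lift_definition modulation :: "'a::euclidean_space \<Rightarrow> 'a L2 \<Rightarrow> 'a L2"
  is "\<lambda>\<omega> f t. exp (2 * of_real pi * \<i> * of_real (t \<bullet> \<omega>)) * f t"
proof -
  fix \<omega> :: 'a and f g :: "'a \<Rightarrow> complex"
  have *: "square_integrable (\<lambda>t. exp (2 * of_real pi * \<i> * of_real (t \<bullet> \<omega>)) * f t)"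
    if "square_integrable f" for f :: "'a \<Rightarrow> complex"
    by (rule square_integrable_mult_bounded[OF that, where K = 1]) (auto simp: norm_exp_eq_Re)
  assume "L2_rel f g"
  then show "L2_rel (\<lambda>t. exp (2 * of_real pi * \<i> * of_real (t \<bullet> \<omega>)) * f t)
      (\<lambda>t. exp (2 * of_real pi * \<i> * of_real (t \<bullet> \<omega>)) * g t)"
    by (auto simp: L2_rel_def * elim: eventually_mono)
qed

definition tf_shift :: "real ^ ('d + 'd) \<Rightarrow> (real ^ 'd::finite) L2 \<Rightarrow> (real ^ 'd) L2" where
  "tf_shift z f = modulation (freq_part z) (translation (time_part z) f)"

definition sym_tf_shift :: "real ^ ('d + 'd) \<Rightarrow> (real ^ 'd::finite) L2 \<Rightarrow> (real ^ 'd) L2" where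
  "sym_tf_shift z f =
     cscale (exp (- (of_real pi * \<i> * of_real (time_part z \<bullet> freq_part z)))) (tf_shift z f)"

section \<open>Symplectic matrices\<close>

definition symp_J :: "real ^ ('d + 'd) ^ ('d::finite + 'd)" where
  "symp_J = (\<chi> i j. case (i, j) of
       (Inl a, Inr b) \<Rightarrow> if a = b then 1 else 0
     | (Inr a, Inl b) \<Rightarrow> if a = b then -1 else 0
     | _ \<Rightarrow> 0)"

definition symplectic :: "real ^ ('d + 'd) ^ ('d::finite + 'd) \<Rightarrow> bool" where
  "symplectic S \<longleftrightarrow> transpose S ** symp_J ** S = symp_J"

lemma symplectic_mult_matrix_inv:
  fixes A B :: "real ^ ('d + 'd) ^ ('d::finite + 'd)"
  assumes "invertible A" and eq: "transpose A ** symp_J ** A = transpose B ** symp_J ** B"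
  shows "symplectic (B ** matrix_inv A)"
proof -
  have AA: "A ** matrix_inv A = mat 1" 
    using someI_ex[OF \<open>invertible A\<close>[unfolded invertible_def]] by (simp add: matrix_inv_def)
  have "transpose (B ** matrix_inv A) ** symp_J ** (B ** matrix_inv A)
      = transpose (matrix_inv A) ** (transpose B ** symp_J ** B) ** matrix_inv A"
    by (simp add: matrix_transpose_mul matrix_mul_assoc)
  also have "\<dots> = transpose (A ** matrix_inv A) ** symp_J ** (A ** matrix_inv A)"
    unfolding eq[symmetric] by (simp add: matrix_transpose_mul matrix_mul_assoc)
  finally show ?thesis by (simp add: symplectic_def AA transpose_mat)
qed

text \<open>This relation is only meant for unitary \<open>U\<close> and symplectic \<open>S\<close>.\<close>

definition rho_related ::
  "((real ^ 'd::finite) L2 \<Rightarrow> (real ^ 'd) L2) \<Rightarrow> real ^ ('d + 'd) ^ ('d + 'd) \<Rightarrow> bool" where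
  "rho_related U S \<longleftrightarrow> (\<forall>z. U \<circ> sym_tf_shift z \<circ> cadjoint U = sym_tf_shift (S *v z))"

definition circ :: "real ^ ('d + 'd) ^ ('d + 'd) \<Rightarrow> real ^ ('d + 'd) ^ ('d::finite + 'd)" where
  "circ A = (- symp_J) ** transpose (matrix_inv A)"

section \<open>Gabor systems\<close>

definition int_lattice :: "(real ^ 'n) set" where
  "int_lattice = {k. \<forall>i. k $ i \<in> \<int>}"

definition gabor_coeff_sq ::
  "(real ^ 'd::finite) L2 \<Rightarrow> real ^ ('d + 'd) ^ ('d + 'd) \<Rightarrow> (real ^ 'd) L2 \<Rightarrow> real ^ ('d + 'd) \<Rightarrow> real"
  where "gabor_coeff_sq g A f k = (cmod (cinner f (tf_shift (A *v k) g)))\<^sup>2"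

definition bessel_bound ::
  "(real ^ 'd::finite) L2 \<Rightarrow> real ^ ('d + 'd) ^ ('d + 'd) \<Rightarrow> real \<Rightarrow> bool" where
  "bessel_bound g A C \<longleftrightarrow> C > 0 \<and>
     (\<forall>f. gabor_coeff_sq g A f summable_on int_lattice \<and>
          (\<Sum>\<^sub>\<infinity>k\<in>int_lattice. gabor_coeff_sq g A f k) \<le> C * (norm f)\<^sup>2)"

definition bessel_sequence ::
  "(real ^ 'd::finite) L2 \<Rightarrow> real ^ ('d + 'd) ^ ('d + 'd) \<Rightarrow> bool" where
  "bessel_sequence g A \<longleftrightarrow> (\<exists>C. bessel_bound g A C)"

text \<open>Only meaningful for Bessel sequences: \<open>infsum\<close> is \<open>0\<close> on divergent sums.\<close>

definition lower_frame_bound ::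
  "(real ^ 'd::finite) L2 \<Rightarrow> real ^ ('d + 'd) ^ ('d + 'd) \<Rightarrow> real \<Rightarrow> bool" where
  "lower_frame_bound g A C \<longleftrightarrow> C > 0 \<and>
     (\<forall>f. C * (norm f)\<^sup>2 \<le> (\<Sum>\<^sub>\<infinity>k\<in>int_lattice. gabor_coeff_sq g A f k))"

definition gabor_frame ::
  "(real ^ 'd::finite) L2 \<Rightarrow> real ^ ('d + 'd) ^ ('d + 'd) \<Rightarrow> bool" where
  "gabor_frame g A \<longleftrightarrow> bessel_sequence g A \<and> (\<exists>C. lower_frame_bound g A C)"

text \<open>The infimum is attained unless \<open>g = 0\<close>, when every \<open>C > 0\<close> is a Bessel bound and the value
  below is \<open>0\<close>.\<close>

definition optimal_bessel_bound ::
  "(real ^ 'd::finite) L2 \<Rightarrow> real ^ ('d + 'd) ^ ('d + 'd) \<Rightarrow> real" where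
  "optimal_bessel_bound g A = Inf {C. bessel_bound g A C}"

definition optimal_lower_frame_bound ::
  "(real ^ 'd::finite) L2 \<Rightarrow> real ^ ('d + 'd) ^ ('d + 'd) \<Rightarrow> real" where
  "optimal_lower_frame_bound g A = Sup {C. lower_frame_bound g A C}"

text \<open>For Bessel sequences the series converges unconditionally in norm, which is the convergence
  that \<open>infsum\<close> refers to.\<close>

definition frame_operator ::
  "real ^ ('d + 'd) ^ ('d + 'd) \<Rightarrow> (real ^ 'd::finite) L2 \<Rightarrow> (real ^ 'd) L2 \<Rightarrow>
     (real ^ 'd) L2 \<Rightarrow> (real ^ 'd) L2" where
  "frame_operator A g h f =
     (\<Sum>\<^sub>\<infinity>k\<in>int_lattice. cscale (cinner f (tf_shift (A *v k) g)) (tf_shift (A *v k) h))"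

end

theory Submission
  imports Defs
begin

text \<open>If \<open>S\<close> is the symplectic matrix to which \<open>U\<close> is related, then \<open>U\<close> maps \<open>\<pi>(Mk)g\<close> to a unimodular
  multiple of \<open>\<pi>(SMk)Ug\<close>, and the phase depends on \<open>k\<close> but not on \<open>g\<close>. Hence the moduli of the Gabor
  coefficients of \<open>f\<close> with respect to \<open>g\<close> and of \<open>Uf\<close> with respect to \<open>Ug\<close> agree, and the phases cancel
  in the frame operator. For the adjoint lattices, put \<open>K = A\<^sup>T J A = B\<^sup>T J B\<close>; then \<open>J\<^sup>2 = -I\<close> gives
  \<open>circ A = A K\<^sup>-\<^sup>1\<close> and \<open>circ B = B K\<^sup>-\<^sup>1\<close>, so \<open>B A\<^sup>-\<^sup>1\<close> also maps \<open>circ A\<close> to \<open>circ B\<close>.\<close>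

section \<open>The complex Hilbert space structure\<close>

lemma cscale_cscale: "cscale a (cscale b f) = cscale (a * b) f"
  by transfer (auto simp: L2_rel_def mult.assoc intro!: square_integrable_cmult)

lemma cscale_one: "cscale 1 f = f"
  by transfer (auto simp: L2_rel_def)

lemma cinner_cscale_right: "cinner f (cscale c g) = cnj c * cinner f g"
proof transfer
  fix c :: complex and f g :: "'a \<Rightarrow> complex"
  have "(\<lambda>t. f t * cnj (c * g t)) = (\<lambda>t. cnj c * (f t * cnj (g t)))"
    by (simp add: fun_eq_iff)
  then show "(LINT t|lborel. f t * cnj (c * g t)) = cnj c * (LINT t|lborel. f t * cnj (g t))"
    by simp
qed

text \<open>The real parts already suffice: they are the real inner product, and in a real inner
  product space the values \<open>inner f g\<close> over all \<open>f\<close> determine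
  \<open>g\<close>.\<close>

lemma cinner_right_eqI:
  assumes "\<And>f. cinner f g = cinner f h"
  shows "g = h"
proof -
  have "\<forall>f. inner f g = inner f h"
    by (simp add: inner_L2_def assms)
  then show ?thesis by (simp only: vector_eq_ldot)
qed

section \<open>Unitary operators\<close>

lemma unitary_operator_cscale: "unitary_operator U \<Longrightarrow> U (cscale c f) = cscale c (U f)"
  by (simp add: unitary_operator_def)

lemma unitary_operator_cinner: "unitary_operator U \<Longrightarrow> cinner (U f) (U g) = cinner f g"
  by (simp add: unitary_operator_def)

lemma unitary_operator_norm: "unitary_operator U \<Longrightarrow> norm (U f) = norm f"
  by (simp add: norm_eq_sqrt_inner inner_L2_def unitary_operator_cinner)

lemma unitary_operator_bounded_linear:
  assumes "unitary_operator U"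
  shows "bounded_linear U"
proof
  show "U (f + g) = U f + U g" for f g
    using assms by (simp add: unitary_operator_def)
  show "U (r *\<^sub>R f) = r *\<^sub>R U f" for r f
    using assms by (simp add: unitary_operator_cscale scaleR_L2_def)
  show "\<exists>K. \<forall>f. norm (U f) \<le> norm f * K"
    using assms by (intro exI[of _ 1]) (simp add: unitary_operator_norm)
qed

lemma unitary_operator_bij:
  assumes "unitary_operator U"
  shows "bij U"
proof (rule bijI)
  show "inj U"
  proof (rule injI)
    fix f g assume "U f = U g"
    then have "cinner h f = cinner h g" for h
      using assms by (metis unitary_operator_cinner)
    then show "f = g" by (rule cinner_right_eqI)
  qed
  show "surj U" using assms by (simp add: unitary_operator_def)
qed

lemma unitary_operator_inv:
  assumes U: "unitary_operator U"
  shows "unitary_operator (inv U)"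
proof -
  note b = unitary_operator_bij[OF U]
  have UV: "U (inv U f) = f" for f
    using b by (simp add: bij_is_surj surj_f_inv_f)
  have VU: "inv U (U f) = f" for f
    using b by (simp add: bij_is_inj)
  have "inv U (f + g) = inv U f + inv U g" for f g
  proof -
    have "U (inv U f + inv U g) = U (inv U f) + U (inv U g)"
      using U by (simp only: unitary_operator_def)
    then show ?thesis by (metis UV VU)
  qed
  moreover have "inv U (cscale c f) = cscale c (inv U f)" for c f
    using unitary_operator_cscale[OF U] by (metis UV VU)
  moreover have "cinner (inv U f) (inv U g) = cinner f g" for f g
    using U by (metis UV unitary_operator_cinner)
  moreover have "surj (inv U)"
    using b by (simp add: bij_imp_bij_inv bij_is_surj)
  ultimately show ?thesis by (simp add: unitary_operator_def)
qed

text \<open>\<open>cadjoint\<close> is a definite description, so existence and uniqueness are both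
  due. Writing \<open>g = U (inv U g)\<close> and using that \<open>U\<close> preserves
  \<open>cinner\<close> gives existence; nondegeneracy of \<open>cinner\<close> gives
  uniqueness.\<close>

lemma cadjoint_unitary_operator:
  assumes U: "unitary_operator U"
  shows "cadjoint U = inv U"
  unfolding cadjoint_def
proof (rule the_equality)
  have UV: "U (inv U f) = f" for f
    using unitary_operator_bij[OF U] by (simp add: bij_is_surj surj_f_inv_f)
  show *: "\<forall>f g. cinner (U f) g = cinner f (inv U g)"
    using U by (metis UV unitary_operator_cinner)
  fix T assume "\<forall>f g. cinner (U f) g = cinner f (T g)"
  with * show "T = inv U"
    by (intro ext cinner_right_eqI) metis
qed

text \<open>Both \<open>U\<close> and \<open>inv U\<close> are bounded and linear, so the two
  families are summable together. If they are not, both sums take the default value 0, and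
  \<open>U 0 = 0\<close>.\<close>

lemma infsum_unitary_operator:
  assumes U: "unitary_operator U"
  shows "(\<Sum>\<^sub>\<infinity>k\<in>I. U (F k)) = U (\<Sum>\<^sub>\<infinity>k\<in>I. F k)"
proof (rule infsum_bounded_linear_strong)
  show "bounded_linear U" by (rule unitary_operator_bounded_linear[OF U])
  moreover have "bounded_linear (inv U)"
    by (rule unitary_operator_bounded_linear[OF unitary_operator_inv[OF U]])
  moreover have "inv U (U f) = f" for f
    using unitary_operator_bij[OF U] by (simp add: bij_is_inj)
  ultimately show "(\<lambda>k. U (F k)) summable_on I \<longleftrightarrow> F summable_on I"
    by (rule summable_on_bounded_linear_iff)
qed

section \<open>Covariance of time-frequency shifts\<close>

lemma rho_related_sym_tf_shift:
  assumes U: "unitary_operator U" and "rho_related U S"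
  shows "U (sym_tf_shift z f) = sym_tf_shift (S *v z) (U f)"
proof -
  have "(U \<circ> sym_tf_shift z \<circ> cadjoint U) (U f) = sym_tf_shift (S *v z) (U f)"
    using assms(2) by (simp add: rho_related_def)
  then show ?thesis
    using unitary_operator_bij[OF U] by (simp add: cadjoint_unitary_operator[OF U] bij_is_inj)
qed

lemma tf_shift_eq_sym_tf_shift:
  "tf_shift z f = cscale (exp (of_real pi * \<i> * of_real (time_part z \<bullet> freq_part z))) (sym_tf_shift z f)"
  by (simp add: sym_tf_shift_def cscale_cscale cscale_one flip: exp_add)

lemma rho_related_tf_shift:
  assumes U: "unitary_operator U" and S: "rho_related U S"
  obtains c where "cmod c = 1" and "\<And>f. tf_shift (S *v z) (U f) = cscale c (U (tf_shift z f))"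
proof
  \<comment> \<open>\<open>?a z\<close> is the phase that turns the symmetric shift at
    \<open>z\<close> into \<open>tf_shift z\<close>. The witness trades the phase at
    \<open>z\<close> for the one at \<open>S *v z\<close>; no vector enters it, so one
    \<open>c\<close> serves all \<open>f\<close>.\<close>
  let ?a = "\<lambda>z. exp (of_real pi * \<i> * of_real (time_part z \<bullet> freq_part z)) :: complex"
  show "cmod (?a (S *v z) * inverse (?a z)) = 1"
    by (simp add: norm_mult norm_inverse)
  show "tf_shift (S *v z) (U f) = cscale (?a (S *v z) * inverse (?a z)) (U (tf_shift z f))" for f
    by (simp add: mult.assoc tf_shift_eq_sym_tf_shift unitary_operator_cscale[OF U] cscale_cscale
        rho_related_sym_tf_shift[OF U S])
qed

section \<open>Gabor systems\<close>

lemma gabor_coeff_sq_unitary: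
  assumes U: "unitary_operator U" and S: "rho_related U S"
  shows "gabor_coeff_sq (U g) (S ** M) (U f) = gabor_coeff_sq g M f"
proof
  fix k
  obtain c where "cmod c = 1" "\<And>f. tf_shift (S *v (M *v k)) (U f) = cscale c (U (tf_shift (M *v k) f))"
    using rho_related_tf_shift[OF U S] by blast
  then show "gabor_coeff_sq (U g) (S ** M) (U f) k = gabor_coeff_sq g M f k"
    by (simp add: gabor_coeff_sq_def cinner_cscale_right unitary_operator_cinner[OF U] norm_mult
        flip: matrix_vector_mul_assoc)
qed

text \<open>By surjectivity, the test vectors in a bound for \<open>U g\<close> may be taken of the
  form \<open>U f\<close>, where the coefficients are known.\<close>

lemma all_unitary_operator_iff:
  assumes "unitary_operator U"
  shows "(\<forall>f. P f) \<longleftrightarrow> (\<forall>f. P (U f))"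
  using bij_is_surj[OF unitary_operator_bij[OF assms]] by (metis surjD)

lemma bessel_bound_unitary:
  assumes U: "unitary_operator U" and S: "rho_related U S"
  shows "bessel_bound (U g) (S ** M) C \<longleftrightarrow> bessel_bound g M C"
  unfolding bessel_bound_def
  by (subst all_unitary_operator_iff[OF U])
     (simp add: unitary_operator_norm[OF U] gabor_coeff_sq_unitary[OF U S])

lemma lower_frame_bound_unitary:
  assumes U: "unitary_operator U" and S: "rho_related U S"
  shows "lower_frame_bound (U g) (S ** M) C \<longleftrightarrow> lower_frame_bound g M C"
  unfolding lower_frame_bound_def
  by (subst all_unitary_operator_iff[OF U])
     (simp add: unitary_operator_norm[OF U] gabor_coeff_sq_unitary[OF U S])

lemma frame_operator_unitary:
  assumes U: "unitary_operator U" and S: "rho_related U S"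
  shows "frame_operator (S ** M) (U g) (U h) = U \<circ> frame_operator M g h \<circ> cadjoint U"
proof -
  \<comment> \<open>On vectors \<open>U f\<close> the identity can be checked term by term;
    surjectivity of \<open>U\<close> then covers every vector.\<close>
  have "frame_operator (S ** M) (U g) (U h) (U f) = U (frame_operator M g h f)" for f
  proof -
    have "cscale (cinner (U f) (tf_shift ((S ** M) *v k) (U g))) (tf_shift ((S ** M) *v k) (U h))
        = U (cscale (cinner f (tf_shift (M *v k) g)) (tf_shift (M *v k) h))" for k
    proof -
      obtain c where c: "cmod c = 1"
        and eq: "\<And>f. tf_shift (S *v (M *v k)) (U f) = cscale c (U (tf_shift (M *v k) f))"
        using rho_related_tf_shift[OF U S] by blast
      \<comment> \<open>The shift of \<open>h\<close> contributes \<open>c\<close>; the shift of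
        \<open>g\<close>, in the conjugate-linear slot of \<open>cinner\<close>, contributes
        \<open>cnj c\<close>.\<close>
      have "c * cnj c = 1"
        using c complex_norm_square[of c] by simp
      then have "cnj c * x * c = x" for x
        by (simp add: mult.commute flip: mult.assoc)
      then have "cscale (cnj c * x * c) f = cscale x f" for x and f :: "(real ^ 'd) L2"
        by (simp only:)
      then show ?thesis
        by (simp only: eq cinner_cscale_right unitary_operator_cinner[OF U] cscale_cscale
            unitary_operator_cscale[OF U] flip: matrix_vector_mul_assoc)
    qed
    then show ?thesis
      by (simp add: frame_operator_def infsum_unitary_operator[OF U])
  qed
  then show ?thesis
    using bij_is_surj[OF unitary_operator_bij[OF U]]
    by (simp add: fun_eq_iff cadjoint_unitary_operator[OF U]) (metis surj_f_inv_f)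
qed

section \<open>The adjoint lattice\<close>

lemma sum_UNIV_sum_type:
  fixes f :: "'a::finite + 'b::finite \<Rightarrow> 'c::comm_monoid_add"
  shows "(\<Sum>i\<in>UNIV. f i) = (\<Sum>i\<in>UNIV. f (Inl i)) + (\<Sum>i\<in>UNIV. f (Inr i))"
proof -
  have "(\<Sum>i\<in>UNIV. f i) = (\<Sum>i\<in>UNIV <+> UNIV. f i)" by simp
  also have "\<dots> = (\<Sum>i\<in>UNIV. f (Inl i)) + (\<Sum>i\<in>UNIV. f (Inr i))"
    by (subst sum.Plus) (simp_all add: o_def)
  finally show ?thesis .
qed

lemma uminus_symp_J_mult: "(- symp_J) ** symp_J = mat 1"
proof -
  have "((- symp_J) ** symp_J) $ i $ j = (mat 1 :: real ^ ('a + 'a) ^ ('a + 'a)) $ i $ j"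
    for i j :: "'a + 'a"
    \<comment> \<open>Each entry is a sum over the two index blocks; pulling the products into the
      conditionals leaves sums of Kronecker deltas.\<close>
    by (cases i; cases j)
       (simp_all add: matrix_matrix_mult_def symp_J_def mat_def sum_UNIV_sum_type
         sum_negf if_distrib[of "\<lambda>x. x * _"] if_distrib[of "\<lambda>x. _ * x"] if_distrib[of uminus]
         cong: if_cong)
  then show ?thesis by (simp add: vec_eq_iff)
qed

lemma invertible_symp_J: "invertible symp_J"
  using uminus_symp_J_mult invertible_right_inverse invertible_left_inverse by blast

lemma matrix_inv_right:
  fixes A :: "real ^ 'n ^ 'n"
  assumes "invertible A"
  shows "A ** matrix_inv A = mat 1"
  using someI_ex[OF assms[unfolded invertible_def]] by (simp add: matrix_inv_def)

lemma matrix_inv_left: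
  fixes A :: "real ^ 'n ^ 'n"
  assumes "invertible A"
  shows "matrix_inv A ** A = mat 1"
  using someI_ex[OF assms[unfolded invertible_def]] by (simp add: matrix_inv_def)

text \<open>The transposed factors cancel first, then \<open>- symp_J\<close> meets
  \<open>symp_J\<close>. This is \<open>circ A\<close> = A K^(-1) with K cleared to the other
  side.\<close>

lemma circ_mult:
  assumes "invertible A"
  shows "circ A ** (transpose A ** symp_J ** A) = A"
proof -
  have "circ A ** (transpose A ** symp_J ** A)
      = (- symp_J) ** transpose (A ** matrix_inv A) ** symp_J ** A"
    by (simp add: circ_def matrix_transpose_mul matrix_mul_assoc)
  also have "\<dots> = A"
    by (simp add: matrix_inv_right[OF assms] transpose_mat uminus_symp_J_mult)
  finally show ?thesis .
qed

lemma mult_circ: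
  fixes A B :: "real ^ ('d + 'd) ^ ('d::finite + 'd)"
  assumes A: "invertible A" and B: "invertible B"
    and eq: "transpose A ** symp_J ** A = transpose B ** symp_J ** B"
  shows "B ** matrix_inv A ** circ A = circ B"
proof -
  define K where "K = transpose A ** symp_J ** A"
  have "B ** matrix_inv A ** circ A ** K = B ** (matrix_inv A ** (circ A ** K))"
    by (simp only: matrix_mul_assoc)
  also have "\<dots> = B ** (matrix_inv A ** A)"
    by (simp only: K_def circ_mult[OF A])
  \<comment> \<open>Both sides equal \<open>B\<close>: by \<open>eq\<close>, \<open>K\<close> is
    also the form built from \<open>B\<close>, so \<open>circ_mult\<close> applies to
    \<open>B\<close> as well.\<close>
  also have "\<dots> = circ B ** K"
    by (simp add: K_def eq circ_mult[OF B] matrix_inv_left[OF A])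
  finally have "B ** matrix_inv A ** circ A ** (K ** matrix_inv K) = circ B ** (K ** matrix_inv K)"
    by (simp add: matrix_mul_assoc)
  moreover have "invertible K"
    unfolding K_def by (intro invertible_mult transpose_invertible A invertible_symp_J)
  ultimately show ?thesis by (simp add: matrix_inv_right)
qed

theorem theorem3p1:
  fixes A B :: "real ^ ('d + 'd) ^ ('d::finite + 'd)"
    and U :: "(real ^ 'd) L2 \<Rightarrow> (real ^ 'd) L2"
  assumes "invertible A" and "invertible B"
    and "transpose A ** symp_J ** A = transpose B ** symp_J ** B"
    and "unitary_operator U" and "rho_related U (B ** matrix_inv A)"
  shows "\<forall>(M, N) \<in> {(A, B), (circ A, circ B)}. \<forall>g h.
      (bessel_sequence g M \<longleftrightarrow> bessel_sequence (U g) N) \<and>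
      (gabor_frame g M \<longleftrightarrow> gabor_frame (U g) N) \<and>
      (bessel_sequence g M \<and> bessel_sequence h M \<longrightarrow>
         frame_operator N (U g) (U h) = U \<circ> frame_operator M g h \<circ> cadjoint U) \<and>
      (bessel_sequence g M \<longrightarrow> optimal_bessel_bound g M = optimal_bessel_bound (U g) N) \<and>
      (gabor_frame g M \<longrightarrow>
         optimal_lower_frame_bound g M = optimal_lower_frame_bound (U g) N \<and>
         optimal_bessel_bound g M = optimal_bessel_bound (U g) N)"
proof -
  define S where "S = B ** matrix_inv A"
  note US = assms(4) assms(5)[folded S_def]
  have "S ** A = B"
    by (simp add: S_def matrix_inv_left[OF assms(1)] flip: matrix_mul_assoc)
  moreover have "S ** circ A = circ B"
    unfolding S_def by (rule mult_circ[OF assms(1-3)])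
  \<comment> \<open>Both pairs have the shape \<open>(M, S ** M)\<close>, so the covariance results
    treat the lattices and their adjoints alike.\<close>
  ultimately have SM: "N = S ** M" if "(M, N) \<in> {(A, B), (circ A, circ B)}" for M N
    using that by auto
  show ?thesis
  proof (intro ballI case_prodI2)
    fix p M N assume "p \<in> {(A, B), (circ A, circ B)}" and "p = (M, N)"
    then have "(M, N) \<in> {(A, B), (circ A, circ B)}" by simp
    then have N: "N = S ** M" by (rule SM)
    \<comment> \<open>Equality as predicates of the constant gives more than equivalence of
      existence: the optimal bounds are the \<open>Inf\<close> and \<open>Sup\<close> of identical
      sets.\<close>
    have "bessel_bound (U g) N = bessel_bound g M"
      and "lower_frame_bound (U g) N = lower_frame_bound g M" for g
      unfolding N by (auto simp: fun_eq_iff bessel_bound_unitary[OF US] lower_frame_bound_unitary[OF US])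
    moreover have "frame_operator N (U g) (U h) = U \<circ> frame_operator M g h \<circ> cadjoint U" for g h
      unfolding N by (rule frame_operator_unitary[OF US])
    ultimately show "\<forall>g h.
      (bessel_sequence g M \<longleftrightarrow> bessel_sequence (U g) N) \<and>
      (gabor_frame g M \<longleftrightarrow> gabor_frame (U g) N) \<and>
      (bessel_sequence g M \<and> bessel_sequence h M \<longrightarrow>
         frame_operator N (U g) (U h) = U \<circ> frame_operator M g h \<circ> cadjoint U) \<and>
      (bessel_sequence g M \<longrightarrow> optimal_bessel_bound g M = optimal_bessel_bound (U g) N) \<and>
      (gabor_frame g M \<longrightarrow>
         optimal_lower_frame_bound g M = optimal_lower_frame_bound (U g) N \<and>
         optimal_bessel_bound g M = optimal_bessel_bound (U g) N)"
      by (simp add: bessel_sequence_def gabor_frame_def optimal_bessel_bound_def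
          optimal_lower_frame_bound_def)
  qed
qed

end
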